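(* Let $n\ge3$, $0<m<\frac{n-2}{n}$, $\beta<0$, $\alpha=\frac{2\beta}{1-m}$ and $\lambda_1>\lambda_2>0$, and let $f_{\lambda_1},f_{\lambda_2}$ be as defined in the context. Then there exist constants $0<\delta_2<1$ and $c_4>c_3>0$ such that $$c_3r^{-\frac{2}{1-m}}(\log r^{-1})^{\frac{m}{1-m}}\le f_{\lambda_2}(r)-f_{\lambda_1}(r)\le c_4r^{-\frac{2}{1-m}}(\log r^{-1})^{\frac{m}{1-m}}\quad\forall\,0<r\le\delta_2.$$
   Context: Let $f_1$ be the unique positive solution on $(0,\infty)$ of $\frac{n-1}{m}\left((f^m)_{rr}+\frac{n-1}{r}(f^m)_r\right)+\alpha f+\beta r f_r=0$ with $\lim_{r\to\infty}r^{\frac{n-2}{m}}f(r)=1$ (it exists and is unique). For $\lambda>0$ put $f_\lambda(r)=\lambda^{\frac{2}{1-m}}f_1(\lambda r)$. *)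

theory Defs
  imports "HOL-Analysis.Analysis"
begin

text \<open>
  Classical positive solutions on \<open>(0, \<infinity>)\<close> of
  \<open>(n-1)/m * ((f^m)_rr + (n-1)/r * (f^m)_r) + \<alpha> f + \<beta> r f_r = 0\<close>.
  Twice differentiability of \<open>f\<close> together with positivity makes \<open>f^m\<close> twice differentiable,
  so all occurrences of \<open>deriv\<close> are genuine derivatives; the equation then forces the
  second derivative of \<open>f\<close> to be continuous. Values of \<open>f\<close> outside \<open>(0, \<infinity>)\<close> are irrelevant.
\<close>

definition positive_radial_solution ::
    "nat \<Rightarrow> real \<Rightarrow> real \<Rightarrow> real \<Rightarrow> (real \<Rightarrow> real) \<Rightarrow> bool" where
  "positive_radial_solution n m \<alpha> \<beta> f \<longleftrightarrow>
     (\<forall>r>0. f r > 0 \<and> f differentiable (at r) \<and> deriv f differentiable (at r) \<and>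
        (real n - 1) / m *
            (deriv (deriv (\<lambda>s. f s powr m)) r + (real n - 1) / r * deriv (\<lambda>s. f s powr m) r)
          + \<alpha> * f r + \<beta> * r * deriv f r = 0)"

definition unit_decay_at_infinity :: "nat \<Rightarrow> real \<Rightarrow> (real \<Rightarrow> real) \<Rightarrow> bool" where
  "unit_decay_at_infinity n m f \<longleftrightarrow>
     ((\<lambda>r. r powr ((real n - 2) / m) * f r) \<longlongrightarrow> 1) at_top"

definition rescaled :: "real \<Rightarrow> (real \<Rightarrow> real) \<Rightarrow> real \<Rightarrow> real \<Rightarrow> real" where
  "rescaled m f lam r = lam powr (2 / (1 - m)) * f (lam * r)"

end

theory Submission
  imports Defs
begin

text \<open>
  Put \<open>t = - ln r\<close>, \<open>w = r\<^sup>2 f powr (1 - m)\<close> and \<open>u = - q - m r f' / f\<close> with \<open>q = 2 m / (1 - m)\<close>.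
  The equation becomes the autonomous system \<open>u' = (u + q) (B - u) - k w u\<close>, \<open>w' = M u w\<close> with
  \<open>B = n - 2 - q\<close>, \<open>k = - \<beta> / (n - 1)\<close>, \<open>M = (1 - m) / m\<close>, and the decay of \<open>f\<close> at infinity says that
  \<open>w\<close> vanishes as \<open>t\<close> tends to \<open>-\<infinity>\<close>. Hence \<open>u\<close> becomes positive, and barrier arguments
  give in turn that \<open>u\<close> is bounded, that \<open>w\<close> tends to infinity, and that \<open>u\<close> tends to \<open>0\<close> with
  \<open>u w\<close> tending to \<open>q B / k\<close>; so \<open>w'\<close> has a positive limit and \<open>w\<close> grows linearly.
  Finally \<open>f\<^sub>\<lambda>(r) = r powr (- 2 / (1 - m)) * g (t - ln \<lambda>)\<close> with \<open>g = w powr (1 / (1 - m))\<close>, and the mean value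
  theorem applied to \<open>g\<close>, whose derivative behaves like a constant times \<open>t powr (m / (1 - m))\<close>,
  gives the two-sided bound.
\<close>

section \<open>Barrier arguments for differentiable functions of one real variable\<close>

text \<open>At the first time \<open>x\<close> reached \<open>A\<close> its derivative would be
  negative, so \<open>x\<close> would already exceed \<open>A\<close> shortly before.\<close>

lemma stays_below:
  fixes x x' :: "real \<Rightarrow> real"
  assumes deriv: "\<And>t. t \<ge> T \<Longrightarrow> (x has_real_derivative x' t) (at t)"
    and neg: "\<And>t. t \<ge> T \<Longrightarrow> x t = A \<Longrightarrow> x' t < 0"
    and start: "x T < A" and t: "t \<ge> T"
  shows "x t < A"
proof (rule ccontr)
  assume nless: "\<not> x t < A"
  have cont: "continuous_on {T..s} x" for s
    by (rule DERIV_continuous_on[where D = x'])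
      (use deriv in \<open>auto intro: has_field_derivative_at_within\<close>)
  define S where "S = {s \<in> {T..t}. A \<le> x s}"
  have "closed S"
    unfolding S_def by (intro continuous_on_closed_Collect_le continuous_on_const cont closed_atLeastAtMost)
  moreover have "S \<noteq> {}" using nless t by (auto simp: S_def)
  moreover have bdd: "bdd_below S" by (auto simp: S_def intro!: bdd_belowI[of _ T])
  ultimately have cS: "Inf S \<in> S" by (intro closed_contains_Inf)
  define c where "c = Inf S"
  have c: "T \<le> c" "c \<le> t" "A \<le> x c" using cS by (auto simp: S_def c_def)
  have before: "x s < A" if "T \<le> s" "s < c" for s
    using cInf_lower[OF _ bdd, of s] that c unfolding c_def S_def by force
  have "T < c" using start c by (cases "T = c") auto
  \<comment> \<open>Membership in \<open>S\<close> gives only \<open>A \<le> x c\<close>; the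
    intermediate value theorem upgrades this to equality, which \<open>neg\<close> needs.\<close>
  obtain s where s: "T \<le> s" "s \<le> c" "x s = A"
    using IVT'[of x T A c] start c cont[of c] by auto
  then have "x c = A" using before[of s] by (cases "s = c") auto
  then have "x' c < 0" using neg c by auto
  then obtain d where d: "d > 0" "\<And>h. h > 0 \<Longrightarrow> h < d \<Longrightarrow> x c < x (c - h)"
    using DERIV_neg_dec_left[OF deriv[OF c(1)]] by blast
  define h where "h = min d (c - T) / 2"
  have h: "h > 0" "h < d" "T \<le> c - h" using d(1) \<open>T < c\<close> by (auto simp: h_def min_def field_simps)
  show False using d(2)[OF h(1,2)] before[of "c - h"] h \<open>x c = A\<close> by auto
qed

text \<open>Above the level, \<open>x\<close> falls at rate at least \<open>c\<close>, so it cannot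
  remain there forever; once below, \<open>stays_below\<close> traps it.\<close>

lemma eventually_below:
  fixes x x' :: "real \<Rightarrow> real"
  assumes deriv: "\<And>t. (x has_real_derivative x' t) (at t)"
    and decr: "\<forall>\<^sub>F t in at_top. x t \<ge> A \<longrightarrow> x' t \<le> - c" and "c > 0"
  shows "\<forall>\<^sub>F t in at_top. x t < A"
proof -
  obtain T where T: "\<And>t. t \<ge> T \<Longrightarrow> x t \<ge> A \<Longrightarrow> x' t \<le> - c"
    using decr by (auto simp: eventually_at_top_linorder)
  have "\<exists>t1\<ge>T. x t1 < A"
  proof (rule ccontr)
    assume "\<not> ?thesis"
    then have ge: "x t \<ge> A" if "t \<ge> T" for t using that by force
    \<comment> \<open>By this time, descent at rate \<open>c\<close> has brought \<open>x\<close>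
      down to \<open>A - 1\<close> or lower.\<close>
    define t where "t = T + (x T - A + 1) / c"
    have "T < t" using ge[of T] \<open>c > 0\<close> by (auto simp: t_def)
    obtain z where z: "z > T" "z < t" "x t - x T = (t - T) * x' z"
      using MVT2[OF \<open>T < t\<close>, of x x'] deriv by blast
    have "(t - T) * x' z \<le> (t - T) * (- c)"
      using z T[of z] ge[of z] by (intro mult_left_mono) auto
    also have "\<dots> = - (x T - A + 1)" using \<open>c > 0\<close> by (simp add: t_def)
    finally have "x t < A" using z by simp
    then show False using ge[of t] \<open>T < t\<close> by auto
  qed
  then obtain t1 where t1: "t1 \<ge> T" "x t1 < A" by blast
  have "x t < A" if "t \<ge> t1" for t
  proof (rule stays_below[of t1 x x', OF deriv _ t1(2) that])
    show "x' s < 0" if "t1 \<le> s" "x s = A" for s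
      using T[of s] that t1(1) \<open>c > 0\<close> by simp
  qed
  then show ?thesis by (auto simp: eventually_at_top_linorder)
qed

lemma eventually_above:
  fixes x x' :: "real \<Rightarrow> real"
  assumes "\<And>t. (x has_real_derivative x' t) (at t)"
    and "\<forall>\<^sub>F t in at_top. x t \<le> A \<longrightarrow> x' t \<ge> c" and "c > 0"
  shows "\<forall>\<^sub>F t in at_top. x t > A"
  using eventually_below[of "\<lambda>t. - x t" "\<lambda>t. - x' t" "- A" c] assms
  by (auto intro: DERIV_minus)

section \<open>Long-time behaviour of the autonomous system\<close>

locale radial_flow =
  fixes u w :: "real \<Rightarrow> real" and q B k M :: real
  assumes q: "q > 0" and B: "B > 0" and k: "k > 0" and M: "M > 0"
    and w_pos: "w t > 0"
    and u_deriv: "(u has_real_derivative ((u t + q) * (B - u t) - k * w t * u t)) (at t)"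
    and w_deriv: "(w has_real_derivative M * u t * w t) (at t)"
    and w_vanishes: "(w \<longlongrightarrow> 0) at_bot"
begin

text \<open>If \<open>u\<close> were never positive, \<open>w\<close> would be nonincreasing, hence
  at least \<open>w 0 > 0\<close> on the negative half-line, against \<open>w_vanishes\<close>. Once
  positive, \<open>u\<close> cannot return to \<open>0\<close>, where its derivative is
  \<open>q * B > 0\<close>.\<close>

lemma u_pos: "\<forall>\<^sub>F t in at_top. u t > 0"
proof -
  have "\<exists>T. u T > 0"
  proof (rule ccontr)
    assume "\<not> ?thesis"
    then have le: "u t \<le> 0" for t by (meson not_less)
    have "w 0 \<le> w t" if "t \<le> 0" for t
      by (rule DERIV_nonpos_imp_nonincreasing[OF that])
        (use w_deriv le w_pos M in \<open>metis less_imp_le mult_nonneg_nonpos mult_nonpos_nonneg\<close>)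
    then have "\<forall>\<^sub>F t in at_bot. w 0 \<le> w t"
      by (auto simp: eventually_at_bot_linorder)
    then have "w 0 \<le> 0"
      by (intro tendsto_lowerbound[OF w_vanishes]) auto
    then show False using w_pos[of 0] by simp
  qed
  then obtain T where T: "u T > 0" by blast
  have "- u t < 0" if "t \<ge> T" for t
  proof (rule stays_below[of T "\<lambda>t. - u t"])
    show "((\<lambda>t. - u t) has_real_derivative - ((u t + q) * (B - u t) - k * w t * u t)) (at t)" for t
      by (intro DERIV_minus u_deriv)
  qed (use T that q B in auto)
  then show ?thesis by (auto simp: eventually_at_top_linorder)
qed

lemma u_bounded: "\<forall>\<^sub>F t in at_top. u t < B + 1"
proof (rule eventually_below[OF u_deriv])
  have "(u t + q) * (B - u t) - k * w t * u t \<le> - q" if "u t \<ge> B + 1" for t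
  proof -
    have "(u t + q) * (B - u t) \<le> (u t + q) * (- 1)"
      using that B q by (intro mult_left_mono) auto
    moreover have "k * w t * u t \<ge> 0" using that B k w_pos[of t] by simp
    ultimately show ?thesis using that B by (simp del: mult_minus_right)
  qed
  then show "\<forall>\<^sub>F t in at_top. u t \<ge> B + 1 \<longrightarrow> (u t + q) * (B - u t) - k * w t * u t \<le> - q"
    by simp
qed (rule q)

text \<open>Since \<open>w\<close> is eventually nondecreasing, the alternative is that it stays
  below some \<open>W\<close>. Then the damping of \<open>u\<close> is bounded, \<open>u\<close>
  stays away from \<open>0\<close>, and \<open>w\<close> grows at a fixed positive rate past
  \<open>W\<close>.\<close>

lemma w_at_top: "filterlim w at_top at_top"
  unfolding filterlim_at_top
proof
  fix W :: real
  obtain T where T: "\<And>t. t \<ge> T \<Longrightarrow> 0 < u t \<and> u t < B + 1"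
    using eventually_conj[OF u_pos u_bounded] by (auto simp: eventually_at_top_linorder)
  have mono: "w s \<le> w t" if "T \<le> s" "s \<le> t" for s t
  proof (rule DERIV_nonneg_imp_nondecreasing[OF that(2)])
    fix x assume "s \<le> x" "x \<le> t"
    then have "M * u x * w x \<ge> 0" using T[of x] M w_pos[of x] that by simp
    then show "\<exists>y. (w has_real_derivative y) (at x) \<and> 0 \<le> y" using w_deriv by blast
  qed
  show "\<forall>\<^sub>F t in at_top. W \<le> w t"
  proof (rule ccontr)
    assume no: "\<not> ?thesis"
    have below: "w t < W" if "t \<ge> T" for t
    proof (rule ccontr)
      assume "\<not> w t < W"
      then have "W \<le> w s" if "s \<ge> t" for s using mono[of t s] \<open>t \<ge> T\<close> that by simp
      then show False using no by (auto simp: eventually_at_top_linorder)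
    qed
    have "W > 0" using below[of T] w_pos[of T] by simp
    \<comment> \<open>The derivative of \<open>u\<close> is
      \<open>q * B - u * (q - B + u + k * w)\<close>. \<open>D\<close> bounds the bracket when
      \<open>u < B + 1\<close> and \<open>w < W\<close>, and \<open>e\<close> is chosen so that
      \<open>e * D\<close> is half of \<open>q * B\<close>.\<close>
    define D where "D = q + B + 1 + k * W"
    define e where "e = q * B / (2 * D)"
    have D: "D > 0" using q B k \<open>W > 0\<close> by (simp add: D_def add_pos_pos)
    have e: "e > 0" using D q B by (simp add: e_def)
    have "\<forall>\<^sub>F t in at_top. u t > e"
    proof (rule eventually_above[OF u_deriv])
      have "(u t + q) * (B - u t) - k * w t * u t \<ge> q * B / 2" if "t \<ge> T" "u t \<le> e" for t
      proof -
        have "u t * (q - B + u t + k * w t) \<le> u t * D"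
          using T[OF that(1)] below[OF that(1)] B k unfolding D_def
          by (intro mult_left_mono) (smt (verit) mult_left_mono)+
        also have "\<dots> \<le> e * D" using that(2) D by (intro mult_right_mono) auto
        also have "\<dots> = q * B / 2" using D by (simp add: e_def)
        finally show ?thesis by (simp add: algebra_simps)
      qed
      then show "\<forall>\<^sub>F t in at_top. u t \<le> e \<longrightarrow> (u t + q) * (B - u t) - k * w t * u t \<ge> q * B / 2"
        by (auto simp: eventually_at_top_linorder)
    qed (use q B in simp)
    then have "\<forall>\<^sub>F t in at_top. w t \<le> W \<longrightarrow> M * u t * w t \<ge> M * e * w T"
      using eventually_ge_at_top[of T]
    proof eventually_elim
      case (elim t)
      have "M * e * w T \<le> M * u t * w t"
        using elim M e mono[of T t] w_pos by (intro mult_mono) (auto intro: less_imp_le)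
      then show ?case by simp
    qed
    then have "\<forall>\<^sub>F t in at_top. w t > W"
      by (rule eventually_above[OF w_deriv]) (use M e w_pos in simp)
    then show False using no by (auto elim!: notE eventually_mono)
  qed
qed

text \<open>While \<open>u\<close> is at least \<open>e\<close>, the damping
  \<open>k * w * u\<close> is at least \<open>k * w * e\<close>, which tends to infinity and beats
  the term \<open>(u + q) * (B - u)\<close>, bounded above by \<open>C\<close>.\<close>

lemma u_tendsto: "(u \<longlongrightarrow> 0) at_top"
proof (rule order_tendstoI)
  fix a :: real assume "a < 0"
  then show "\<forall>\<^sub>F t in at_top. a < u t" using u_pos by (auto elim: eventually_mono)
next
  fix e :: real assume e: "0 < e"
  define C where "C = (B + 1 + q) * B"
  show "\<forall>\<^sub>F t in at_top. u t < e"
  proof (rule eventually_below[OF u_deriv])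
    have "\<forall>\<^sub>F t in at_top. w t \<ge> (C + 1) / (k * e)"
      using w_at_top by (auto simp: filterlim_at_top)
    then show "\<forall>\<^sub>F t in at_top. u t \<ge> e \<longrightarrow> (u t + q) * (B - u t) - k * w t * u t \<le> - 1"
      using u_bounded
    proof eventually_elim
      case (elim t)
      show ?case
      proof
        assume "u t \<ge> e"
        have "(u t + q) * (B - u t) \<le> (B + 1 + q) * B"
        proof -
          have "(u t + q) * (B - u t) \<le> (u t + q) * B"
            using \<open>u t \<ge> e\<close> e q by (intro mult_left_mono) auto
          also have "\<dots> \<le> (B + 1 + q) * B" using elim B by (intro mult_right_mono) auto
          finally show ?thesis .
        qed
        moreover have "C + 1 \<le> k * w t * e" using elim k e by (simp add: field_simps)
        moreover have "k * w t * e \<le> k * w t * u t"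
          using \<open>u t \<ge> e\<close> k w_pos[of t] by (intro mult_left_mono) auto
        ultimately show "(u t + q) * (B - u t) - k * w t * u t \<le> - 1" by (simp add: C_def)
      qed
    qed
  qed simp
qed

text \<open>The product \<open>v = u * w\<close> satisfies \<open>v' = w * (E - k * v)\<close> with
  \<open>E\<close> tending to \<open>q * B\<close>. As \<open>w\<close> is eventually at least
  \<open>1\<close>, this drives \<open>v\<close> towards \<open>q * B / k\<close>.\<close>

lemma uw_tendsto: "((\<lambda>t. u t * w t) \<longlongrightarrow> q * B / k) at_top"
proof -
  define E where "E t = (u t + q) * (B - u t) + M * u t * u t" for t
  have "(E \<longlongrightarrow> (0 + q) * (B - 0) + M * 0 * 0) at_top"
    unfolding E_def by (intro tendsto_intros u_tendsto)
  then have E: "(E \<longlongrightarrow> q * B) at_top" by simp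
  have deriv: "((\<lambda>t. u t * w t) has_real_derivative w t * (E t - k * (u t * w t))) (at t)" for t
    by (rule DERIV_cong[OF DERIV_mult[OF u_deriv w_deriv]]) (simp add: E_def algebra_simps)
  have w1: "\<forall>\<^sub>F t in at_top. 1 \<le> w t" using w_at_top by (auto simp: filterlim_at_top)
  show ?thesis
  proof (rule order_tendstoI)
    fix a assume a: "q * B / k < a"
    \<comment> \<open>Half of the gap: one half absorbs the error in \<open>E\<close>, the other
      remains as the rate of decrease.\<close>
    define c where "c = (k * a - q * B) / 2"
    have c: "c > 0" "q * B + c < k * a" using a k by (auto simp: c_def field_simps)
    show "\<forall>\<^sub>F t in at_top. u t * w t < a"
    proof (rule eventually_below[OF deriv _ c(1)])
      have "\<forall>\<^sub>F t in at_top. E t < q * B + c"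
        using order_tendstoD(2)[OF E] c(1) by simp
      then show "\<forall>\<^sub>F t in at_top. u t * w t \<ge> a \<longrightarrow> w t * (E t - k * (u t * w t)) \<le> - c"
        using w1
      proof eventually_elim
        case (elim t)
        show ?case
        proof
          assume "u t * w t \<ge> a"
          then have "k * a \<le> k * (u t * w t)" using k by simp
          then have "c \<le> k * (u t * w t) - E t" using elim c_def by (simp add: field_simps)
          then have "1 * c \<le> w t * (k * (u t * w t) - E t)"
            using elim c by (intro mult_mono) auto
          then show "w t * (E t - k * (u t * w t)) \<le> - c" by (simp add: algebra_simps)
        qed
      qed
    qed
  next
    fix a assume a: "a < q * B / k"
    define c where "c = (q * B - k * a) / 2"
    have c: "c > 0" using a k by (auto simp: c_def field_simps)
    show "\<forall>\<^sub>F t in at_top. a < u t * w t"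
    proof (rule eventually_above[OF deriv _ c(1)])
      have "\<forall>\<^sub>F t in at_top. q * B - c < E t"
        using order_tendstoD(1)[OF E] c(1) by simp
      then show "\<forall>\<^sub>F t in at_top. u t * w t \<le> a \<longrightarrow> w t * (E t - k * (u t * w t)) \<ge> c"
        using w1
      proof eventually_elim
        case (elim t)
        show ?case
        proof
          assume "u t * w t \<le> a"
          then have "k * (u t * w t) \<le> k * a" using k by simp
          then have "c \<le> E t - k * (u t * w t)" using elim c_def by (simp add: field_simps)
          then have "1 * c \<le> w t * (E t - k * (u t * w t))"
            using elim c by (intro mult_mono) auto
          then show "w t * (E t - k * (u t * w t)) \<ge> c" by simp
        qed
      qed
    qed
  qed
qed

lemma w_linear: "((\<lambda>t. w t / t) \<longlongrightarrow> M * (q * B / k)) at_top"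
proof (rule lhospital_at_top_at_top[where f' = "\<lambda>t. M * u t * w t" and g' = "\<lambda>_. 1"])
  show "((\<lambda>t. M * u t * w t / 1) \<longlongrightarrow> M * (q * B / k)) at_top"
    using tendsto_mult[OF tendsto_const[of M] uw_tendsto] by (simp add: mult.assoc)
qed (auto simp: w_deriv filterlim_ident)

end

section \<open>Increments over shifted arguments\<close>

text \<open>The mean value theorem writes the increment as \<open>(b - a) * g' (z t)\<close>, where
  \<open>z t\<close> stays within bounded distance of \<open>t\<close>; hence \<open>z t / t\<close>
  tends to \<open>1\<close> and the power of \<open>z t\<close> may be replaced by that of
  \<open>t\<close>.\<close>

lemma increment_asymptotics:
  fixes g g' :: "real \<Rightarrow> real"
  assumes deriv: "\<And>t. (g has_real_derivative g' t) (at t)"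
    and lim: "((\<lambda>t. g' t / t powr \<nu>) \<longlongrightarrow> c) at_top" and "a < b"
  shows "((\<lambda>t. (g (t + b) - g (t + a)) / t powr \<nu>) \<longlongrightarrow> (b - a) * c) at_top"
proof -
  have "\<exists>z. t + a < z \<and> z < t + b \<and> g (t + b) - g (t + a) = (b - a) * g' z" for t
    using MVT2[of "t + a" "t + b" g g'] deriv \<open>a < b\<close> by auto
  then obtain z where z: "\<And>t. t + a < z t" "\<And>t. z t < t + b"
      "\<And>t. g (t + b) - g (t + a) = (b - a) * g' (z t)"
    by metis
  have z_top: "filterlim z at_top at_top"
  proof (rule filterlim_at_top_mono)
    show "filterlim (\<lambda>t. a + t) at_top at_top"
      by (rule filterlim_tendsto_add_at_top[OF tendsto_const filterlim_ident])
    show "\<forall>\<^sub>F t in at_top. a + t \<le> z t"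
      using z(1) by (auto intro!: always_eventually less_imp_le simp: add.commute)
  qed
  have ratio: "((\<lambda>t. z t / t) \<longlongrightarrow> 1) at_top"
  proof (rule tendsto_sandwich)
    have lim1: "((\<lambda>t::real. 1 + d / t) \<longlongrightarrow> 1) at_top" for d :: real
      using tendsto_add[OF tendsto_const tendsto_divide_0[OF tendsto_const
        filterlim_at_top_imp_at_infinity[OF filterlim_ident]], of "1::real" d] by simp
    show "((\<lambda>t. 1 + a / t) \<longlongrightarrow> 1) at_top" "((\<lambda>t. 1 + b / t) \<longlongrightarrow> 1) at_top"
      by (rule lim1)+
    have "1 + a / t \<le> z t / t \<and> z t / t \<le> 1 + b / t" if "t > 0" for t
      using divide_right_mono[of "t + a" "z t" t] divide_right_mono[of "z t" "t + b" t] z(1,2)[of t] that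
      by (simp add: add_divide_distrib)
    then show "\<forall>\<^sub>F t in at_top. 1 + a / t \<le> z t / t" "\<forall>\<^sub>F t in at_top. z t / t \<le> 1 + b / t"
      by (auto intro!: eventually_mono[OF eventually_gt_at_top[of 0]])
  qed
  have "((\<lambda>t. (b - a) * (g' (z t) / z t powr \<nu> * (z t / t) powr \<nu>)) \<longlongrightarrow> (b - a) * (c * 1 powr \<nu>)) at_top"
    by (intro tendsto_intros ratio filterlim_compose[OF lim z_top]) auto
  moreover have "\<forall>\<^sub>F t in at_top. (b - a) * (g' (z t) / z t powr \<nu> * (z t / t) powr \<nu>)
      = (g (t + b) - g (t + a)) / t powr \<nu>"
    using eventually_gt_at_top[of 0] filterlim_at_top_dense[THEN iffD1, OF z_top, rule_format, of 0]
    by eventually_elim (simp add: z(3) powr_divide)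
  ultimately show ?thesis by (auto intro: Lim_transform_eventually)
qed

text \<open>The derivative of \<open>w powr p\<close> is
  \<open>p * w powr (p - 1) * (M * u * w)\<close>. Here \<open>w\<close> behaves like
  \<open>l * t\<close> and \<open>M * u * w\<close> tends to the same \<open>l\<close>, so the
  powers combine to \<open>l powr p\<close>.\<close>

lemma (in radial_flow) power_increment:
  assumes "p > 1" "a < b"
  shows "((\<lambda>t. (w (t + b) powr p - w (t + a) powr p) / t powr (p - 1))
    \<longlongrightarrow> (b - a) * (p * (M * (q * B / k)) powr p)) at_top"
proof (rule increment_asymptotics[OF _ _ \<open>a < b\<close>])
  define l where "l = M * (q * B / k)"
  have l: "l > 0" using q B k M by (simp add: l_def)
  show "((\<lambda>t. w t powr p) has_real_derivative p * w t powr (p - 1) * (M * (u t * w t))) (at t)" for t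
    using DERIV_fun_powr[OF w_deriv w_pos, of p t] by (simp add: mult_ac)
  have "((\<lambda>t. p * ((w t / t) powr (p - 1) * (M * (u t * w t)))) \<longlongrightarrow>
      p * (l powr (p - 1) * (M * (q * B / k)))) at_top"
    using l unfolding l_def by (intro tendsto_intros w_linear uw_tendsto) auto
  also have "l powr (p - 1) * (M * (q * B / k)) = l powr p"
    using l unfolding l_def[symmetric] by (simp add: powr_diff)
  finally have "((\<lambda>t. p * ((w t / t) powr (p - 1) * (M * (u t * w t)))) \<longlongrightarrow> p * l powr p) at_top" .
  moreover have "\<forall>\<^sub>F t in at_top. p * ((w t / t) powr (p - 1) * (M * (u t * w t)))
      = p * w t powr (p - 1) * (M * (u t * w t)) / t powr (p - 1)"
    using eventually_gt_at_top[of 0]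
    by eventually_elim (use w_pos in \<open>simp add: powr_divide less_imp_le\<close>)
  ultimately show "((\<lambda>t. p * w t powr (p - 1) * (M * (u t * w t)) / t powr (p - 1)) \<longlongrightarrow>
      p * (M * (q * B / k)) powr p) at_top"
    unfolding l_def by (rule Lim_transform_eventually)
qed

section \<open>From the radial equation to the autonomous system\<close>

text \<open>The equation is invariant under the scaling that defines \<open>rescaled\<close>. In
  scale-invariant quantities such as \<open>r * f' / f\<close> and
  \<open>r^2 * f powr (1 - m)\<close>, it therefore becomes autonomous in
  \<open>t = - ln r\<close>.\<close>

lemma solution_radial_flow:
  fixes n :: nat and m \<beta> :: real and f :: "real \<Rightarrow> real"
  defines "q \<equiv> 2 * m / (1 - m)"
  assumes n: "n \<ge> 3" and m: "0 < m" "m < (real n - 2) / real n" and \<beta>: "\<beta> < 0"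
    and sol: "positive_radial_solution n m (2 * \<beta> / (1 - m)) \<beta> f"
    and decay: "unit_decay_at_infinity n m f"
  shows "radial_flow (\<lambda>t. - q - m * (exp (- t) * deriv f (exp (- t)) / f (exp (- t))))
    (\<lambda>t. (exp (- t))\<^sup>2 * f (exp (- t)) powr (1 - m)) q (real n - 2 - q) (- \<beta> / (real n - 1)) ((1 - m) / m)"
proof -
  define N where "N = real n - 1"
  have N: "N > 0" using n by (simp add: N_def)
  \<comment> \<open>This is what makes \<open>B = n - 2 - 2 * m / (1 - m)\<close> positive.\<close>
  have mn: "m * real n < real n - 2" using m n by (simp add: field_simps)
  have "m * real n < 1 * real n" using mn by linarith
  then have m1: "m < 1" using n by (simp add: mult_less_cancel_right)
  have B: "real n - 2 - q > 0" using mn m1 by (simp add: q_def field_simps)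
  have pos: "f r > 0" if "r > 0" for r
    using sol that by (simp add: positive_radial_solution_def)
  have f1: "(f has_real_derivative deriv f r) (at r)"
    and f2: "(deriv f has_real_derivative deriv (deriv f) r) (at r)" if "r > 0" for r
    using sol that by (simp_all add: positive_radial_solution_def DERIV_deriv_iff_real_differentiable)
  \<comment> \<open>The equation multiplied by \<open>r^2 / f powr m\<close>; the factor
    \<open>m\<close> from differentiating \<open>f powr m\<close> cancels the \<open>1 / m\<close>
    in front.\<close>
  have ode: "N * ((m - 1) * (r * deriv f r / f r)\<^sup>2 + r\<^sup>2 * deriv (deriv f) r / f r + N * (r * deriv f r / f r))
      + r\<^sup>2 * f r powr (1 - m) * (2 * \<beta> / (1 - m) + \<beta> * (r * deriv f r / f r)) = 0"
    if r: "r > 0" for r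
  proof -
    have p1: "((\<lambda>s. f s powr m) has_real_derivative m * f s powr (m - 1) * deriv f s) (at s)"
      if "s > 0" for s
      using DERIV_fun_powr[OF f1[OF that] pos[OF that], of m] by simp
    have "((\<lambda>s. m * f s powr (m - 1) * deriv f s) has_real_derivative
        m * ((m - 1) * f r powr (m - 2) * (deriv f r)\<^sup>2 + f r powr (m - 1) * deriv (deriv f) r)) (at r)"
      by (rule DERIV_cong[OF DERIV_mult[OF DERIV_cmult[OF DERIV_fun_powr[OF f1[OF r] pos[OF r]]] f2[OF r]]])
        (simp add: algebra_simps power2_eq_square)
    then have "(deriv (\<lambda>s. f s powr m) has_real_derivative
        m * ((m - 1) * f r powr (m - 2) * (deriv f r)\<^sup>2 + f r powr (m - 1) * deriv (deriv f) r)) (at r)"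
      by (rule has_field_derivative_transform_within_open[of _ _ _ "{0<..}"])
        (use r in \<open>auto simp: DERIV_imp_deriv[OF p1]\<close>)
    then have p2: "deriv (deriv (\<lambda>s. f s powr m)) r =
        m * ((m - 1) * f r powr (m - 2) * (deriv f r)\<^sup>2 + f r powr (m - 1) * deriv (deriv f) r)"
      by (rule DERIV_imp_deriv)
    define P where "P = f r powr m"
    have P: "P > 0" "f r powr (m - 1) = P / f r" "f r powr (m - 2) = P / (f r)\<^sup>2" "f r powr (1 - m) = f r / P"
      using pos[OF r] by (simp_all add: P_def powr_diff)
    have "N / m * (m * ((m - 1) * (P / (f r)\<^sup>2) * (deriv f r)\<^sup>2 + P / f r * deriv (deriv f) r)
        + N / r * (m * (P / f r) * deriv f r)) + 2 * \<beta> / (1 - m) * f r + \<beta> * r * deriv f r = 0"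
      using sol[unfolded positive_radial_solution_def, rule_format, OF r]
      unfolding p2 DERIV_imp_deriv[OF p1[OF r]] P(2,3) N_def by blast
    then have zero: "r\<^sup>2 / P * (N * ((m - 1) * (P / (f r)\<^sup>2) * (deriv f r)\<^sup>2 + P / f r * deriv (deriv f) r
        + N / r * ((P / f r) * deriv f r)) + 2 * \<beta> / (1 - m) * f r + \<beta> * r * deriv f r) = 0"
      using m(1) by (simp add: distrib_left distrib_right mult.assoc)
    have "r\<^sup>2 / P * (N * ((m - 1) * (P / (f r)\<^sup>2) * (deriv f r)\<^sup>2 + P / f r * deriv (deriv f) r
        + N / r * ((P / f r) * deriv f r)) + c * f r + \<beta> * r * deriv f r) =
        N * ((m - 1) * (r * deriv f r / f r)\<^sup>2 + r\<^sup>2 * deriv (deriv f) r / f r + N * (r * deriv f r / f r))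
      + r\<^sup>2 * (f r / P) * (c + \<beta> * (r * deriv f r / f r))" for c
      using pos[OF r] r P(1) by (simp add: divide_simps) (simp add: algebra_simps power2_eq_square)
    from trans[OF sym[OF this] zero] show ?thesis unfolding P(4) .
  qed
  have comp: "((\<lambda>t. h (exp (- t))) has_real_derivative d * - exp (- t)) (at t)"
    if "(h has_real_derivative d) (at (exp (- t)))" for h :: "real \<Rightarrow> real" and d t
    by (rule DERIV_chain2[where f = h and g = "\<lambda>t. exp (- t)", OF that]) (auto intro!: derivative_eq_intros)
  show ?thesis
  proof
    show "q > 0" using m m1 by (simp add: q_def)
    show "real n - 2 - q > 0" by (rule B)
    show "- \<beta> / (real n - 1) > 0" using \<beta> N unfolding N_def by (intro divide_pos_pos) auto
    show "(1 - m) / m > 0" using m m1 by simp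
  next
    fix t :: real
    define r where "r = exp (- t)"
    have r: "r > 0" by (simp add: r_def)
    define X where "X = r * deriv f r / f r"
    define Z where "Z = r\<^sup>2 * deriv (deriv f) r / f r"
    define W where "W = r\<^sup>2 * f r powr (1 - m)"
    show "(exp (- t))\<^sup>2 * f (exp (- t)) powr (1 - m) > 0"
      using pos[OF r] by (simp add: r_def)
    have "((\<lambda>s. - q - m * (s * deriv f s / f s)) has_real_derivative
        - (m * (((deriv f r + r * deriv (deriv f) r) * f r - (r * deriv f r) * deriv f r) / (f r * f r)))) (at r)"
      using pos[OF r] by (auto intro!: derivative_eq_intros f1[OF r] f2[OF r]) (simp add: algebra_simps)
    from comp[OF this[unfolded r_def]]
    have D: "((\<lambda>t. - q - m * (exp (- t) * deriv f (exp (- t)) / f (exp (- t)))) has_real_derivative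
        - (m * (((deriv f r + r * deriv (deriv f) r) * f r - (r * deriv f r) * deriv f r) / (f r * f r))) * - r) (at t)"
      by (simp add: r_def)
    have "- (m * (((deriv f r + r * deriv (deriv f) r) * f r - (r * deriv f r) * deriv f r) / (f r * f r))) * - r
        = m * (X + Z - X\<^sup>2)"
      using pos[OF r] unfolding X_def Z_def
      by (simp add: divide_simps) (simp add: algebra_simps power2_eq_square)
    also have "\<dots> = ((- q - m * X) + q) * (real n - 2 - q - (- q - m * X)) - - \<beta> / (real n - 1) * W * (- q - m * X)"
    proof -
      \<comment> \<open>This eliminates the second derivative \<open>Z\<close>. After multiplication
        by \<open>m\<close>, the last bracket becomes \<open>\<beta> * (q + m * X)\<close>, that is
        \<open>- \<beta> * u\<close>, which produces the damping term.\<close>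
      have "N * ((m - 1) * X\<^sup>2 + Z + N * X) + W * (2 * \<beta> / (1 - m) + \<beta> * X) = 0"
        using ode[OF r] by (simp add: X_def Z_def W_def)
      then have "m * (N * ((m - 1) * X\<^sup>2 + Z + N * X)) + W * (\<beta> * (q + m * X)) = 0"
        using m(1) by (simp add: q_def) algebra
      then have "m * ((m - 1) * X\<^sup>2 + Z + N * X) = - \<beta> / N * W * (q + m * X)"
        using N by (simp add: field_simps)
      moreover have "real n - 2 - q = N - 1 - q" "- \<beta> / (real n - 1) = - \<beta> / N" by (simp_all add: N_def)
      ultimately show ?thesis by algebra
    qed
    finally show "((\<lambda>t. - q - m * (exp (- t) * deriv f (exp (- t)) / f (exp (- t)))) has_real_derivative
        (- q - m * (exp (- t) * deriv f (exp (- t)) / f (exp (- t))) + q)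
          * (real n - 2 - q - (- q - m * (exp (- t) * deriv f (exp (- t)) / f (exp (- t)))))
        - - \<beta> / (real n - 1) * ((exp (- t))\<^sup>2 * f (exp (- t)) powr (1 - m))
          * (- q - m * (exp (- t) * deriv f (exp (- t)) / f (exp (- t))))) (at t)"
      using D unfolding X_def W_def r_def by simp
    have "((\<lambda>s. s\<^sup>2 * f s powr (1 - m)) has_real_derivative
        2 * r * f r powr (1 - m) + r\<^sup>2 * ((1 - m) * f r powr (- m) * deriv f r)) (at r)"
      using pos[OF r]
      by (auto intro!: derivative_eq_intros DERIV_fun_powr f1[OF r] simp: algebra_simps)
    from comp[OF this[unfolded r_def]]
    have D: "((\<lambda>t. (exp (- t))\<^sup>2 * f (exp (- t)) powr (1 - m)) has_real_derivative
        (2 * r * f r powr (1 - m) + r\<^sup>2 * ((1 - m) * f r powr (- m) * deriv f r)) * - r) (at t)"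
      by (simp add: r_def)
    have pw: "f r powr (1 - m) = f r * f r powr (- m)"
      using pos[OF r] by (simp add: powr_diff powr_minus field_simps)
    have "(2 * r * f r powr (1 - m) + r\<^sup>2 * ((1 - m) * f r powr (- m) * deriv f r)) * - r
        = - (2 + (1 - m) * X) * W"
      using pos[OF r] by (simp add: X_def W_def pw field_simps power2_eq_square)
    also have "\<dots> = (1 - m) / m * (- q - m * X) * W"
      using m m1 by (simp add: q_def field_simps)
    finally show "((\<lambda>t. (exp (- t))\<^sup>2 * f (exp (- t)) powr (1 - m)) has_real_derivative
        (1 - m) / m * (- q - m * (exp (- t) * deriv f (exp (- t)) / f (exp (- t))))
          * ((exp (- t))\<^sup>2 * f (exp (- t)) powr (1 - m))) (at t)"
      using D unfolding X_def W_def r_def by simp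
  next
    \<comment> \<open>With \<open>f\<close> decaying like \<open>r powr (- (n - 2) / m)\<close>, the
      quantity \<open>r^2 * f powr (1 - m)\<close> decays like
      \<open>r powr (- \<gamma>)\<close>.\<close>
    define \<gamma> where "\<gamma> = (1 - m) / m * (real n - 2 - q)"
    have \<gamma>: "\<gamma> > 0" using B m m1 by (simp add: \<gamma>_def)
    have \<gamma>_eq: "(real n - 2) / m * (1 - m) - \<gamma> = 2"
      using m m1 by (simp add: \<gamma>_def q_def field_simps)
    have "((\<lambda>r. (r powr ((real n - 2) / m) * f r) powr (1 - m) * r powr (- \<gamma>)) \<longlongrightarrow> 1 powr (1 - m) * 0) at_top"
      using decay \<gamma> unfolding unit_decay_at_infinity_def
      by (intro tendsto_intros tendsto_neg_powr filterlim_ident) auto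
    moreover have "\<forall>\<^sub>F r in at_top. (r powr ((real n - 2) / m) * f r) powr (1 - m) * r powr (- \<gamma>)
        = r\<^sup>2 * f r powr (1 - m)"
      using eventually_gt_at_top[of 0]
    proof eventually_elim
      case (elim r)
      have "(r powr ((real n - 2) / m) * f r) powr (1 - m) * r powr (- \<gamma>)
          = r powr ((real n - 2) / m * (1 - m) - \<gamma>) * f r powr (1 - m)"
        using elim pos[of r] powr_add[of r "(real n - 2) / m * (1 - m)" "- \<gamma>"]
        by (simp add: powr_mult powr_powr mult_ac)
      then show ?case using elim unfolding \<gamma>_eq by simp
    qed
    ultimately have lim: "((\<lambda>r. r\<^sup>2 * f r powr (1 - m)) \<longlongrightarrow> 0) at_top"
      by (simp add: tendsto_cong)
    have "filterlim (\<lambda>t::real. exp (- t)) at_top at_bot"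
      by (rule filterlim_compose[OF exp_at_top filterlim_uminus_at_top_at_bot])
    from filterlim_compose[OF lim this]
    show "((\<lambda>t. (exp (- t))\<^sup>2 * f (exp (- t)) powr (1 - m)) \<longlongrightarrow> 0) at_bot" .
  qed
qed

text \<open>Rescaling by \<open>lam\<close> is the translation of \<open>t = ln (inverse r)\<close>
  by \<open>- ln lam\<close>, since \<open>\<rho> = lam * r\<close>; the power
  \<open>1 / (1 - m)\<close> recovers \<open>f\<close> from \<open>w\<close>.\<close>

lemma rescaled_eq_power:
  assumes "r > 0" "lam > 0" "m < 1" and pos: "f (lam * r) > 0"
  defines "\<rho> \<equiv> exp (- (ln (inverse r) - ln lam))"
  shows "rescaled m f lam r = r powr (- (2 / (1 - m))) * (\<rho>\<^sup>2 * f \<rho> powr (1 - m)) powr (1 / (1 - m))"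
proof -
  have \<rho>: "\<rho> = lam * r"
    using assms by (simp add: \<rho>_def ln_inverse exp_add)
  have pw: "x\<^sup>2 powr (1 / (1 - m)) = x powr (2 / (1 - m))" if "x > 0" for x :: real
    using that powr_powr[of x 2 "1 / (1 - m)"] by simp
  have "(\<rho>\<^sup>2 * f \<rho> powr (1 - m)) powr (1 / (1 - m)) = \<rho> powr (2 / (1 - m)) * f \<rho>"
    using assms(1-4) \<rho> by (simp add: powr_mult[of "_\<^sup>2"] powr_powr pw)
  also have "\<rho> powr (2 / (1 - m)) = lam powr (2 / (1 - m)) * r powr (2 / (1 - m))"
    using assms(1-2) unfolding \<rho> by (simp add: powr_mult)
  finally show ?thesis
    using assms(1-3) by (simp add: rescaled_def \<rho> powr_minus field_simps)
qed

section \<open>The two-sided bound near the origin\<close>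

theorem corollary3p12:
  fixes n :: nat and m \<alpha> \<beta> lam\<^sub>1 lam\<^sub>2 :: real and f\<^sub>1 :: "real \<Rightarrow> real"
  assumes "n \<ge> 3"
    and "0 < m" and "m < (real n - 2) / real n"
    and "\<beta> < 0" and "\<alpha> = 2 * \<beta> / (1 - m)"
    and "lam\<^sub>1 > lam\<^sub>2" and "lam\<^sub>2 > 0"
    and "positive_radial_solution n m \<alpha> \<beta> f\<^sub>1"
    and "unit_decay_at_infinity n m f\<^sub>1"
  shows "\<exists>\<delta>\<^sub>2 c\<^sub>3 c\<^sub>4 :: real. 0 < \<delta>\<^sub>2 \<and> \<delta>\<^sub>2 < 1 \<and> 0 < c\<^sub>3 \<and> c\<^sub>3 < c\<^sub>4 \<and>
    (\<forall>r. 0 < r \<and> r \<le> \<delta>\<^sub>2 \<longrightarrow>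
      c\<^sub>3 * r powr (- (2 / (1 - m))) * ln (inverse r) powr (m / (1 - m))
        \<le> rescaled m f\<^sub>1 lam\<^sub>2 r - rescaled m f\<^sub>1 lam\<^sub>1 r \<and>
      rescaled m f\<^sub>1 lam\<^sub>2 r - rescaled m f\<^sub>1 lam\<^sub>1 r
        \<le> c\<^sub>4 * r powr (- (2 / (1 - m))) * ln (inverse r) powr (m / (1 - m)))"
proof -
  define q where "q = 2 * m / (1 - m)"
  define w where "w t = (exp (- t))\<^sup>2 * f\<^sub>1 (exp (- t)) powr (1 - m)" for t
  interpret radial_flow "\<lambda>t. - q - m * (exp (- t) * deriv f\<^sub>1 (exp (- t)) / f\<^sub>1 (exp (- t)))"
    w q "real n - 2 - q" "- \<beta> / (real n - 1)" "(1 - m) / m"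
    unfolding q_def w_def using assms by (intro solution_radial_flow) auto
  have m1: "m < 1" using M assms(2) by (simp add: zero_less_divide_iff)
  define p where "p = 1 / (1 - m)"
  have p: "p > 1" "p - 1 = m / (1 - m)" using assms(2) m1 by (auto simp: p_def field_simps)
  \<comment> \<open>The limit given by \<open>power_increment\<close> for the shifts
    \<open>- ln lam\<^sub>1\<close> and \<open>- ln lam\<^sub>2\<close>; it is positive because
    \<open>lam\<^sub>2 < lam\<^sub>1\<close>. The final constants \<open>c / 2\<close> and
    \<open>2 * c\<close> lie on either side of it.\<close>
  define c where "c = (- ln lam\<^sub>2 - - ln lam\<^sub>1) *
    (p * ((1 - m) / m * (q * (real n - 2 - q) / (- \<beta> / (real n - 1)))) powr p)"
  have lt: "- ln lam\<^sub>1 < - ln lam\<^sub>2" using assms by simp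
  have lim: "((\<lambda>t. (w (t + - ln lam\<^sub>2) powr p - w (t + - ln lam\<^sub>1) powr p) / t powr (p - 1)) \<longlongrightarrow> c) at_top"
    unfolding c_def by (rule power_increment[OF p(1) lt])
  have "(1 - m) / m * (q * (real n - 2 - q) / (- \<beta> / (real n - 1))) > 0"
    using q B k M by (metis divide_pos_pos mult_pos_pos)
  then have c: "c > 0" using lt p(1) unfolding c_def by (intro mult_pos_pos) auto
  have "\<forall>\<^sub>F t in at_top. c / 2 < (w (t + - ln lam\<^sub>2) powr p - w (t + - ln lam\<^sub>1) powr p) / t powr (p - 1)"
    using order_tendstoD(1)[OF lim, of "c / 2"] c by simp
  moreover have "\<forall>\<^sub>F t in at_top. (w (t + - ln lam\<^sub>2) powr p - w (t + - ln lam\<^sub>1) powr p) / t powr (p - 1) < 2 * c"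
    using order_tendstoD(2)[OF lim, of "2 * c"] c by simp
  ultimately obtain T where T: "\<And>t. t \<ge> T \<Longrightarrow>
      c / 2 < (w (t + - ln lam\<^sub>2) powr p - w (t + - ln lam\<^sub>1) powr p) / t powr (p - 1) \<and>
      (w (t + - ln lam\<^sub>2) powr p - w (t + - ln lam\<^sub>1) powr p) / t powr (p - 1) < 2 * c"
    by (metis (no_types, lifting) eventually_at_top_linorder eventually_conj)
  \<comment> \<open>For \<open>r \<le> \<delta>\<close> the variable
    \<open>t = ln (inverse r)\<close> is at least \<open>T\<close>; the \<open>1\<close> ensures
    \<open>t > 0\<close> and \<open>\<delta> < 1\<close>.\<close>
  define \<delta> where "\<delta> = exp (- max T 1)"
  have bounds: "c / 2 * r powr (- (2 / (1 - m))) * ln (inverse r) powr (m / (1 - m))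
        \<le> rescaled m f\<^sub>1 lam\<^sub>2 r - rescaled m f\<^sub>1 lam\<^sub>1 r \<and>
      rescaled m f\<^sub>1 lam\<^sub>2 r - rescaled m f\<^sub>1 lam\<^sub>1 r
        \<le> 2 * c * r powr (- (2 / (1 - m))) * ln (inverse r) powr (m / (1 - m))"
    if r: "0 < r" "r \<le> \<delta>" for r
  proof -
    define t where "t = ln (inverse r)"
    have "ln r \<le> ln \<delta>" using r by (subst ln_le_cancel_iff) auto
    then have "ln r \<le> - max T 1" by (simp add: \<delta>_def)
    then have t: "T \<le> t" "0 < t" unfolding t_def ln_inverse by linarith+
    have resc: "rescaled m f\<^sub>1 lam r = r powr (- (2 / (1 - m))) * w (t + - ln lam) powr p"
      if "lam > 0" for lam
    proof -
      have "f\<^sub>1 (lam * r) > 0" using assms(8) that r by (simp add: positive_radial_solution_def)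
      from rescaled_eq_power[where f = f\<^sub>1, OF r(1) that m1 this] show ?thesis
        by (simp add: w_def t_def p_def)
    qed
    define D where "D = w (t + - ln lam\<^sub>2) powr p - w (t + - ln lam\<^sub>1) powr p"
    have D: "c / 2 * t powr (p - 1) \<le> D" "D \<le> 2 * c * t powr (p - 1)"
      using T[OF t(1)] t(2) unfolding D_def[symmetric] by (simp_all add: field_simps)
    have "rescaled m f\<^sub>1 lam\<^sub>2 r - rescaled m f\<^sub>1 lam\<^sub>1 r = r powr (- (2 / (1 - m))) * D"
      using assms(6,7) by (simp add: resc D_def algebra_simps)
    then show ?thesis
      using mult_left_mono[OF D(1), of "r powr (- (2 / (1 - m)))"]
        mult_left_mono[OF D(2), of "r powr (- (2 / (1 - m)))"]
      by (simp add: t_def[symmetric] p(2)[symmetric] mult_ac)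
  qed
  have "0 < \<delta>" "\<delta> < 1" by (simp_all add: \<delta>_def)
  then show ?thesis using bounds c by (intro exI[of _ \<delta>] exI[of _ "c / 2"] exI[of _ "2 * c"]) auto
qed

end
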